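(* Let $\alpha,\beta\in(0,1]$, $\gamma:=1-\alpha$, $\nu:=1-\beta$, let $A,B\in\mathbb{R}$, and let $L=L(t,u,v,w):\mathbb{T}^\kappa\times\mathbb{R}\times\mathbb{R}\times\mathbb{R}\to\mathbb{R}$ be a function whose second-order partial derivatives $L_{uu},L_{uv},L_{uw},L_{vw},L_{vv},L_{ww}$ exist and are continuous. Consider the problem $$\mathcal{L}(y)=\int_{a}^{b}L\bigl(t,y^{\sigma}(t),{}_a\Delta_h^\alpha y(t),{}_h\Delta_b^\beta y(t)\bigr)\Delta t\longrightarrow\min,\qquad y(a)=A,\ y(b)=B,$$ over functions $y:\mathbb{T}\to\mathbb{R}$. If $\hat{y}:\mathbb{T}\to\mathbb{R}$ is a local minimum for this problem, then for all $t\in\mathbb{T}^{\kappa^2}$ $$\begin{aligned} &h^2 L_{uu}[\hat{y}](t)+2h^{\gamma+1}L_{uv}[\hat{y}](t)+2h^{\nu+1}(\nu-1)L_{uw}[\hat{y}](t)+h^{2\gamma}(\gamma-1)^2L_{vv}[\hat{y}](\sigma(t))\\ &+2h^{\nu+\gamma}(\gamma-1)L_{vw}[\hat{y}](\sigma(t))+2h^{\nu+\gamma}(\nu-1)L_{vw}[\hat{y}](t)+h^{2\nu}(\nu-1)^2L_{ww}[\hat{y}](t)+h^{2\nu}L_{ww}[\hat{y}](\sigma(t))\\ &+\int_{a}^{t}h^3L_{ww}[\hat{y}](s)\left(\frac{\nu(1-\nu)}{\Gamma(\nu+1)}(t+\nu h-\sigma(s))_h^{(\nu-2)}\right)^2\Delta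 s\\ &+h^{2\gamma}L_{vv}[\hat{y}](t)+\int_{\sigma(\sigma(t))}^{b}h^3L_{vv}[\hat{y}](s)\left(\frac{\gamma(\gamma-1)}{\Gamma(\gamma+1)}(s+\gamma h-\sigma(\sigma(t)))_h^{(\gamma-2)}\right)^2\Delta s\ \ge\ 0, \end{aligned}$$ where $[\hat{y}](t)=\bigl(t,\hat{y}^{\sigma}(t),{}_a\Delta_h^\alpha\hat{y}(t),{}_h\Delta_b^\beta\hat{y}(t)\bigr)$ for $t\in\mathbb{T}^\kappa$.
   Context: Let $a\in\mathbb{R}$, $h>0$, $b=a+kh$ with $k\in\mathbb{N}$, $k\ge 1$, and $\mathbb{T}=\{a,a+h,\dots,b\}$, $\mathbb{T}^\kappa=\{a,a+h,\dots,b-h\}$, $\mathbb{T}^{\kappa^2}=\{a,\dots,b-2h\}$ (empty if $k=1$). Put $\sigma(t)=t+h$, $\rho(t)=t-h$, $f^\sigma(t)=f(\sigma(t))$. The delta derivative is $f^\Delta(t)=\frac{f(t+h)-f(t)}{h}$. The delta integral is $\int_c^d f(t)\Delta t=\sum_{i=0}^{(d-c)/h-1}f(c+ih)\,h$ for $d-c\in h\mathbb{N}_0$ (equal to $0$ if $c=d$). The $h$-factorial function is $x_h^{(y)}:=h^y\,\Gamma(\frac{x}{h}+1)/\Gamma(\frac{x}{h}+1-y)$ for $x,y\in\mathbb{R}$, with the convention that division at a pole yields zero. Fractional $h$-sums. Let $\mu>0$. For $f:\mathbb{T}\to\mathbb{R}$ and $t\in\mathbb{T}$, $${}_a\Delta_h^{-\mu}f(t+\mu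 h)=\frac{1}{\Gamma(\mu)}\sum_{s\in\{a,a+h,\dots,t\}}(t+\mu h-\sigma(s))_h^{(\mu-1)}f(s)\,h,$$ $${}_h\Delta_b^{-\mu}f(t-\mu h)=\frac{1}{\Gamma(\mu)}\sum_{s\in\{t,t+h,\dots,b\}}(s+\mu h-\sigma(t))_h^{(\mu-1)}f(s)\,h,$$ and for $\mu=0$: ${}_a\Delta_h^{0}f(t)={}_h\Delta_b^{0}f(t)=f(t)$. Fractional differences. For $0<\alpha\le1$ and $\gamma=1-\alpha$, the left fractional difference is ${}_a\Delta_h^\alpha f(t):=\bigl({}_a\Delta_h^{-\gamma}f(t+\gamma h)\bigr)^\Delta$, and for $0<\beta\le1$ and $\nu=1-\beta$ the right fractional difference is ${}_h\Delta_b^\beta f(t):=-\bigl({}_h\Delta_b^{-\nu}f(t-\nu h)\bigr)^\Delta$, for $t\in\mathbb{T}^\kappa$, where the delta derivative is taken of the functions $t\mapsto {}_a\Delta_h^{-\gamma}f(t+\gamma h)$ and $t\mapsto{}_h\Delta_b^{-\nu}f(t-\nu h)$ on $\mathbb{T}$. Local minimum. For $f:\mathbb{T}\to\mathbb{R}$ put $\|f\|=\max_{t\in\mathbb{T}^\kappa}|f^\sigma(t)|+\max_{t\in\mathbb{T}^\kappa}|{}_a\Delta_h^\alpha f(t)|+\max_{t\in\mathbb{T}^\kappa}|{}_h\Delta_b^\beta f(t)|$. A function $\hat{y}:\mathbb{T}\to\mathbb{R}$ with $\hat y(a)=A$, $\hat y(b)=B$ is a local minimum for the problem if there is $\delta>0$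 such that $\mathcal{L}(\hat y)\le\mathcal{L}(y)$ for all $y:\mathbb{T}\to\mathbb{R}$ with $y(a)=A$, $y(b)=B$ and $\|y-\hat y\|<\delta$. Subscripts $u,v,w$ on $L$ denote partial derivatives with respect to the second, third and fourth arguments. *)

theory Defs
  imports "HOL-Analysis.Analysis"
begin

text \<open>A function on a grid is represented by a total function on the reals; nothing below
  depends on its values outside the grid.\<close>

text \<open>The points c, c + h, c + 2h, ... not exceeding d. With b = a + k h, the time scale is
  \<open>hgrid h a b\<close>, and its truncations (without the last one or two points) are
  \<open>hgrid h a (b - h)\<close> and \<open>hgrid h a (b - 2 * h)\<close>; the latter is empty if k = 1.\<close>
definition hgrid :: "real \<Rightarrow> real \<Rightarrow> real \<Rightarrow> real set" where
  "hgrid h c d = {c + real i * h | i :: nat. c + real i * h \<le> d}"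

definition fwd :: "real \<Rightarrow> real \<Rightarrow> real" where
  "fwd h t = t + h"

definition delta_deriv :: "real \<Rightarrow> (real \<Rightarrow> real) \<Rightarrow> real \<Rightarrow> real" where
  "delta_deriv h f t = (f (t + h) - f t) / h"

text \<open>Meant for d - c a natural multiple of h > 0, where the floor is exact.\<close>
definition delta_integral :: "real \<Rightarrow> real \<Rightarrow> real \<Rightarrow> (real \<Rightarrow> real) \<Rightarrow> real" where
  "delta_integral h c d f = (\<Sum>i < nat \<lfloor>(d - c) / h\<rfloor>. f (c + real i * h) * h)"

text \<open>\<open>Gamma\<close> is 0 at its poles, so a pole in the denominator makes the quotient zero.\<close>
definition hfactorial :: "real \<Rightarrow> real \<Rightarrow> real \<Rightarrow> real" where
  "hfactorial h x y = h powr y * Gamma (x / h + 1) / Gamma (x / h + 1 - y)"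

text \<open>The left fractional sum of order \<open>\<mu>\<close> is a function of the shifted argument
  \<open>x = t + \<mu> h\<close>, and the right one of \<open>x = t - \<mu> h\<close>, with t in the grid.\<close>
definition left_sum :: "real \<Rightarrow> real \<Rightarrow> real \<Rightarrow> (real \<Rightarrow> real) \<Rightarrow> real \<Rightarrow> real" where
  "left_sum h a \<mu> f x =
     (if \<mu> = 0 then f x
      else let t = x - \<mu> * h in
        1 / Gamma \<mu> * (\<Sum>s \<in> hgrid h a t. hfactorial h (t + \<mu> * h - fwd h s) (\<mu> - 1) * f s * h))"

definition right_sum :: "real \<Rightarrow> real \<Rightarrow> real \<Rightarrow> (real \<Rightarrow> real) \<Rightarrow> real \<Rightarrow> real" where
  "right_sum h b \<mu> f x =
     (if \<mu> = 0 then f x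
      else let t = x + \<mu> * h in
        1 / Gamma \<mu> * (\<Sum>s \<in> hgrid h t b. hfactorial h (s + \<mu> * h - fwd h t) (\<mu> - 1) * f s * h))"

definition left_diff :: "real \<Rightarrow> real \<Rightarrow> real \<Rightarrow> (real \<Rightarrow> real) \<Rightarrow> real \<Rightarrow> real" where
  "left_diff h a \<alpha> f = delta_deriv h (\<lambda>t. left_sum h a (1 - \<alpha>) f (t + (1 - \<alpha>) * h))"

definition right_diff :: "real \<Rightarrow> real \<Rightarrow> real \<Rightarrow> (real \<Rightarrow> real) \<Rightarrow> real \<Rightarrow> real" where
  "right_diff h b \<beta> f t = - delta_deriv h (\<lambda>t. right_sum h b (1 - \<beta>) f (t - (1 - \<beta>) * h)) t"

type_synonym lagrangian = "real \<Rightarrow> real \<Rightarrow> real \<Rightarrow> real \<Rightarrow> real"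

text \<open>Partial derivatives in the second, third and fourth argument; \<open>L\<^sub>u\<^sub>v\<close> is \<open>Dv (Du L)\<close>.\<close>
definition Du :: "lagrangian \<Rightarrow> lagrangian" where
  "Du F = (\<lambda>t u v w. deriv (\<lambda>x. F t x v w) u)"
definition Dv :: "lagrangian \<Rightarrow> lagrangian" where
  "Dv F = (\<lambda>t u v w. deriv (\<lambda>x. F t u x w) v)"
definition Dw :: "lagrangian \<Rightarrow> lagrangian" where
  "Dw F = (\<lambda>t u v w. deriv (\<lambda>x. F t u v x) w)"

definition u_differentiable :: "real set \<Rightarrow> lagrangian \<Rightarrow> bool" where
  "u_differentiable D F \<longleftrightarrow> (\<forall>t\<in>D. \<forall>u v w. (\<lambda>x. F t x v w) field_differentiable at u)"
definition v_differentiable :: "real set \<Rightarrow> lagrangian \<Rightarrow> bool" where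
  "v_differentiable D F \<longleftrightarrow> (\<forall>t\<in>D. \<forall>u v w. (\<lambda>x. F t u x w) field_differentiable at v)"
definition w_differentiable :: "real set \<Rightarrow> lagrangian \<Rightarrow> bool" where
  "w_differentiable D F \<longleftrightarrow> (\<forall>t\<in>D. \<forall>u v w. (\<lambda>x. F t u v x) field_differentiable at w)"

definition jointly_continuous :: "real set \<Rightarrow> lagrangian \<Rightarrow> bool" where
  "jointly_continuous D F \<longleftrightarrow> continuous_on (D \<times> UNIV) (\<lambda>(t, u, v, w). F t u v w)"

text \<open>Each mixed derivative is required in one order only; the other order and the symmetry
  then follow from the continuity.\<close>
definition continuous_second_partials :: "real set \<Rightarrow> lagrangian \<Rightarrow> bool" where
  "continuous_second_partials D L \<longleftrightarrow>
     u_differentiable D L \<and> v_differentiable D L \<and> w_differentiable D L \<and>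
     u_differentiable D (Du L) \<and> v_differentiable D (Du L) \<and> w_differentiable D (Du L) \<and>
     v_differentiable D (Dv L) \<and> w_differentiable D (Dv L) \<and> w_differentiable D (Dw L) \<and>
     jointly_continuous D (Du (Du L)) \<and> jointly_continuous D (Dv (Du L)) \<and>
     jointly_continuous D (Dw (Du L)) \<and> jointly_continuous D (Dv (Dv L)) \<and>
     jointly_continuous D (Dw (Dv L)) \<and> jointly_continuous D (Dw (Dw L))"

text \<open>\<open>F[y](t)\<close>: the function F evaluated along y.\<close>
definition along ::
  "real \<Rightarrow> real \<Rightarrow> real \<Rightarrow> real \<Rightarrow> real \<Rightarrow> lagrangian \<Rightarrow> (real \<Rightarrow> real) \<Rightarrow> real \<Rightarrow> real" where
  "along h a b \<alpha> \<beta> F y t = F t (y (fwd h t)) (left_diff h a \<alpha> y t) (right_diff h b \<beta> y t)"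

definition functional ::
  "real \<Rightarrow> real \<Rightarrow> real \<Rightarrow> real \<Rightarrow> real \<Rightarrow> lagrangian \<Rightarrow> (real \<Rightarrow> real) \<Rightarrow> real" where
  "functional h a b \<alpha> \<beta> L y = delta_integral h a b (along h a b \<alpha> \<beta> L y)"

definition frac_norm ::
  "real \<Rightarrow> real \<Rightarrow> real \<Rightarrow> real \<Rightarrow> real \<Rightarrow> (real \<Rightarrow> real) \<Rightarrow> real" where
  "frac_norm h a b \<alpha> \<beta> f =
     (MAX t \<in> hgrid h a (b - h). \<bar>f (fwd h t)\<bar>) +
     (MAX t \<in> hgrid h a (b - h). \<bar>left_diff h a \<alpha> f t\<bar>) +
     (MAX t \<in> hgrid h a (b - h). \<bar>right_diff h b \<beta> f t\<bar>)"

definition local_minimum ::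
  "real \<Rightarrow> real \<Rightarrow> real \<Rightarrow> real \<Rightarrow> real \<Rightarrow> lagrangian \<Rightarrow> real \<Rightarrow> real \<Rightarrow> (real \<Rightarrow> real) \<Rightarrow> bool" where
  "local_minimum h a b \<alpha> \<beta> L A B yh \<longleftrightarrow>
     yh a = A \<and> yh b = B \<and>
     (\<exists>\<delta>>0. \<forall>y. y a = A \<and> y b = B \<and> frac_norm h a b \<alpha> \<beta> (\<lambda>t. y t - yh t) < \<delta> \<longrightarrow>
        functional h a b \<alpha> \<beta> L yh \<le> functional h a b \<alpha> \<beta> L y)"

end

theory Submission
  imports Defs
begin

text \<open>The inequality is the second-variation condition for one test function: the spike \<open>\<eta>\<close> that
  is 1 at the interior grid point \<open>fwd h t\<close> and 0 elsewhere.

  As \<open>\<eta>\<close> vanishes at both ends, \<open>yh + e * \<eta>\<close> satisfies the boundary conditions for every \<open>e\<close>.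
  The fractional differences are linear, so the functional along this line is a finite sum of
  values of \<open>L\<close> along straight lines, and a local minimum makes its second-order Taylor
  coefficient nonnegative (\<open>second_variation_nonneg\<close>). That coefficient is the sum over the grid of
  the Hessian form of \<open>L\<close> (\<open>second_order_expansion\<close>) evaluated at the triples formed by the shift,
  the left difference and the right difference of \<open>\<eta>\<close>.

  These differences are explicit. The weights of a fractional sum of order \<open>\<mu>\<close> are \<open>h powr \<mu>\<close>
  times the binomial coefficients \<open>rising_coeff \<mu>\<close>, and differencing lowers \<open>\<mu>\<close> by one
  (\<open>rising_coeff_diff\<close>). Hence the left difference of \<open>\<eta>\<close> is supported at \<open>t\<close> and later, the right
  difference at \<open>fwd h t\<close> and earlier (\<open>left_diff_spike\<close>, \<open>right_diff_spike\<close>). They meet only at \<open>t\<close>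
  and \<open>fwd h t\<close>, which give the terms outside the integrals. At earlier points only the square of
  the right difference survives, at later points only the square of the left one, and
  \<open>difference_kernel_eq\<close> identifies these squares with the integrands.\<close>

section \<open>Second-order expansion along a line\<close>

lemma mvt_at_increment:
  fixes f :: "real \<Rightarrow> real"
  assumes "\<And>x. f field_differentiable at x"
  shows "\<exists>\<xi>. \<bar>\<xi> - u\<bar> \<le> \<bar>d\<bar> \<and> f (u + d) = f u + d * deriv f \<xi>"
proof -
  have D: "(f has_real_derivative deriv f x) (at x)" for x
    using assms field_differentiable_derivI by blast
  consider "d = 0" | "d > 0" | "d < 0" by linarith
  then show ?thesis
  proof cases
    case 1
    then show ?thesis by auto
  next
    case 2
    then obtain z where "u < z" "z < u + d" "f (u + d) - f u = (u + d - u) * deriv f z"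
      using MVT2[of u "u + d" f "deriv f"] D by auto
    then show ?thesis by (intro exI[of _ z]) auto
  next
    case 3
    then obtain z where "u + d < z" "z < u" "f u - f (u + d) = (u - (u + d)) * deriv f z"
      using MVT2[of "u + d" u f "deriv f"] D by auto
    then show ?thesis by (intro exI[of _ z]) auto
  qed
qed

lemma taylor2_at_increment:
  fixes f :: "real \<Rightarrow> real"
  assumes "\<And>x. f field_differentiable at x" "\<And>x. deriv f field_differentiable at x"
  shows "\<exists>\<xi>. \<bar>\<xi> - u\<bar> \<le> \<bar>d\<bar> \<and> f (u + d) = f u + d * deriv f u + d\<^sup>2 / 2 * deriv (deriv f) \<xi>"
proof -
  define D where "D = (\<lambda>n::nat. \<lambda>x. (deriv ^^ n) f (x + u))"
  have base: "(D m has_real_derivative D (Suc m) x) (at x)" if "m < 2" for m x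
  proof -
    have "((deriv ^^ m) f has_real_derivative (deriv ^^ Suc m) f (x + u)) (at (x + u))"
      using that assms[THEN field_differentiable_derivI] by (auto simp: less_2_cases_iff)
    then show ?thesis
      by (simp add: D_def DERIV_shift)
  qed
  have "\<exists>t. \<bar>t\<bar> \<le> \<bar>d\<bar> \<and> D 0 d = (\<Sum>m<2. D m 0 / fact m * d ^ m) + D 2 t / fact 2 * d ^ 2"
    by (rule Maclaurin_bi_le) (use base in auto)
  then obtain t where "\<bar>t\<bar> \<le> \<bar>d\<bar>"
    "D 0 d = (\<Sum>m<2. D m 0 / fact m * d ^ m) + D 2 t / fact 2 * d ^ 2" by blast
  then show ?thesis
    by (intro exI[of _ "u + t"]) (simp add: D_def numeral_2_eq_2 add_ac mult_ac)
qed

lemma tendsto_if_dist_le_linear: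
  fixes X :: "real \<Rightarrow> real"
  assumes "\<And>e. \<bar>X e - u\<bar> \<le> \<bar>e * c\<bar>"
  shows "(X \<longlongrightarrow> u) (at 0)"
proof -
  have "((\<lambda>e::real. \<bar>e * c\<bar>) \<longlongrightarrow> 0) (at 0)"
    by (auto intro!: tendsto_eq_intros)
  then have "((\<lambda>e. X e - u) \<longlongrightarrow> 0) (at 0)"
    by (rule Lim_null_comparison[rotated]) (use assms in auto)
  then show ?thesis by (simp add: LIM_zero_iff)
qed

text \<open>Twice the second-order Taylor term in the direction \<open>(p, q, r)\<close>, that is, the Hessian
  form, with each mixed derivative in the order of \<open>continuous_second_partials\<close>.\<close>
definition hessian_form :: "lagrangian \<Rightarrow> real \<Rightarrow> real \<Rightarrow> real \<Rightarrow> real \<Rightarrow> real \<Rightarrow> real \<Rightarrow> real \<Rightarrow> real" where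
  "hessian_form F t u v w p q r =
     p\<^sup>2 * Du (Du F) t u v w + 2 * p * q * Dv (Du F) t u v w + 2 * p * r * Dw (Du F) t u v w
   + q\<^sup>2 * Dv (Dv F) t u v w + 2 * q * r * Dw (Dv F) t u v w + r\<^sup>2 * Dw (Dw F) t u v w"

lemma jointly_continuous_tendsto:
  assumes "jointly_continuous D F" "t \<in> D"
    and "(X \<longlongrightarrow> u) (at (0::real))" "(Y \<longlongrightarrow> v) (at 0)" "(Z \<longlongrightarrow> w) (at 0)"
  shows "((\<lambda>e. F t (X e) (Y e) (Z e)) \<longlongrightarrow> F t u v w) (at 0)"
proof -
  have "((\<lambda>e. (\<lambda>(t,u,v,w). F t u v w) (t, X e, Y e, Z e)) \<longlongrightarrow> (\<lambda>(t,u,v,w). F t u v w) (t, u, v, w)) (at 0)"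
    by (rule continuous_on_tendsto_compose[where s = "D \<times> UNIV"])
       (use assms in \<open>auto simp: jointly_continuous_def intro!: tendsto_Pair\<close>)
  then show ?thesis by simp
qed

text \<open>The increment is split along a coordinate path: first \<open>u\<close> changes back to its base value, then
  \<open>v\<close>, then \<open>w\<close>. Each leg is a one-variable Taylor formula; its first-order coefficient is \<open>Du F\<close>
  or \<open>Dv F\<close> at a point where only later coordinates are displaced, and the mean value theorem
  brings it back to the base point at the cost of one mixed derivative. The order
  of the legs is chosen so that the mixed derivatives come out as \<open>Dv (Du F)\<close>, \<open>Dw (Du F)\<close> and
  \<open>Dw (Dv F)\<close>.\<close>
lemma second_order_expansion:
  assumes cont: "continuous_second_partials D F" and t: "t \<in> D"
  shows "((\<lambda>e. (F t (u + e * p) (v + e * q) (w + e * r) - F t u v w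
             - e * (p * Du F t u v w + q * Dv F t u v w + r * Dw F t u v w)) / e\<^sup>2)
          \<longlongrightarrow> hessian_form F t u v w p q r / 2) (at 0)"
proof -
  note C = cont[unfolded continuous_second_partials_def]
  have dF: "(\<lambda>x. F t x v w) field_differentiable at u" "(\<lambda>x. F t u x w) field_differentiable at v"
    "(\<lambda>x. F t u v x) field_differentiable at w" for u v w
    using C t unfolding u_differentiable_def v_differentiable_def w_differentiable_def by auto
  have dF2: "(\<lambda>x. Du F t x v w) field_differentiable at u" "(\<lambda>x. Du F t u x w) field_differentiable at v"
    "(\<lambda>x. Du F t u v x) field_differentiable at w" "(\<lambda>x. Dv F t u x w) field_differentiable at v"
    "(\<lambda>x. Dv F t u v x) field_differentiable at w" "(\<lambda>x. Dw F t u v x) field_differentiable at w" for u v w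
    using C t unfolding u_differentiable_def v_differentiable_def w_differentiable_def by auto
  have Tu: "\<exists>\<xi>. \<bar>\<xi> - u\<bar> \<le> \<bar>d\<bar> \<and> F t (u + d) v w = F t u v w + d * Du F t u v w + d\<^sup>2 / 2 * Du (Du F) t \<xi> v w" for d u v w
    using taylor2_at_increment[of "\<lambda>x. F t x v w" u d] dF(1) dF2(1) by (simp add: Du_def)
  have Tv: "\<exists>\<xi>. \<bar>\<xi> - v\<bar> \<le> \<bar>d\<bar> \<and> F t u (v + d) w = F t u v w + d * Dv F t u v w + d\<^sup>2 / 2 * Dv (Dv F) t u \<xi> w" for d u v w
    using taylor2_at_increment[of "\<lambda>x. F t u x w" v d] dF(2) dF2(4) by (simp add: Dv_def)
  have Tw: "\<exists>\<xi>. \<bar>\<xi> - w\<bar> \<le> \<bar>d\<bar> \<and> F t u v (w + d) = F t u v w + d * Dw F t u v w + d\<^sup>2 / 2 * Dw (Dw F) t u v \<xi>" for d u v w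
    using taylor2_at_increment[of "\<lambda>x. F t u v x" w d] dF(3) dF2(6) by (simp add: Dw_def)
  have Muv: "\<exists>\<xi>. \<bar>\<xi> - v\<bar> \<le> \<bar>d\<bar> \<and> Du F t u (v + d) w = Du F t u v w + d * Dv (Du F) t u \<xi> w" for d u v w
    using mvt_at_increment[of "\<lambda>x. Du F t u x w" v d] dF2(2) by (simp add: Dv_def)
  have Muw: "\<exists>\<xi>. \<bar>\<xi> - w\<bar> \<le> \<bar>d\<bar> \<and> Du F t u v (w + d) = Du F t u v w + d * Dw (Du F) t u v \<xi>" for d u v w
    using mvt_at_increment[of "\<lambda>x. Du F t u v x" w d] dF2(3) by (simp add: Dw_def)
  have Mvw: "\<exists>\<xi>. \<bar>\<xi> - w\<bar> \<le> \<bar>d\<bar> \<and> Dv F t u v (w + d) = Dv F t u v w + d * Dw (Dv F) t u v \<xi>" for d u v w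
    using mvt_at_increment[of "\<lambda>x. Dv F t u v x" w d] dF2(5) by (simp add: Dw_def)
  \<comment> \<open>\<open>X1\<close>, \<open>X2\<close>, \<open>X3\<close> are the Taylor points of the three legs; \<open>X4\<close>, \<open>X5\<close>, \<open>X6\<close> are the
    mean value points that carry the gradient back to \<open>(u, v, w)\<close>.\<close>
  obtain X1 where X1: "\<forall>e. \<bar>X1 e - u\<bar> \<le> \<bar>e * p\<bar>
    \<and> F t (u + e * p) (v + e * q) (w + e * r) = F t u (v + e * q) (w + e * r)
       + (e * p) * Du F t u (v + e * q) (w + e * r) + (e * p)\<^sup>2 / 2 * Du (Du F) t (X1 e) (v + e * q) (w + e * r)"
    by atomize_elim (intro choice allI Tu)
  obtain X2 where X2: "\<forall>e. \<bar>X2 e - v\<bar> \<le> \<bar>e * q\<bar>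
    \<and> F t u (v + e * q) (w + e * r) = F t u v (w + e * r)
       + (e * q) * Dv F t u v (w + e * r) + (e * q)\<^sup>2 / 2 * Dv (Dv F) t u (X2 e) (w + e * r)"
    by atomize_elim (intro choice allI Tv)
  obtain X3 where X3: "\<forall>e. \<bar>X3 e - w\<bar> \<le> \<bar>e * r\<bar>
    \<and> F t u v (w + e * r) = F t u v w
       + (e * r) * Dw F t u v w + (e * r)\<^sup>2 / 2 * Dw (Dw F) t u v (X3 e)"
    by atomize_elim (intro choice allI Tw)
  obtain X4 where X4: "\<forall>e. \<bar>X4 e - v\<bar> \<le> \<bar>e * q\<bar>
    \<and> Du F t u (v + e * q) (w + e * r) = Du F t u v (w + e * r) + (e * q) * Dv (Du F) t u (X4 e) (w + e * r)"
    by atomize_elim (intro choice allI Muv)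
  obtain X5 where X5: "\<forall>e. \<bar>X5 e - w\<bar> \<le> \<bar>e * r\<bar>
    \<and> Du F t u v (w + e * r) = Du F t u v w + (e * r) * Dw (Du F) t u v (X5 e)"
    by atomize_elim (intro choice allI Muw)
  obtain X6 where X6: "\<forall>e. \<bar>X6 e - w\<bar> \<le> \<bar>e * r\<bar>
    \<and> Dv F t u v (w + e * r) = Dv F t u v w + (e * r) * Dw (Dv F) t u v (X6 e)"
    by atomize_elim (intro choice allI Mvw)
  define R where "R = (\<lambda>e. (p\<^sup>2 * Du (Du F) t (X1 e) (v + e * q) (w + e * r)
      + 2 * p * q * Dv (Du F) t u (X4 e) (w + e * r) + 2 * p * r * Dw (Du F) t u v (X5 e)
      + q\<^sup>2 * Dv (Dv F) t u (X2 e) (w + e * r) + 2 * q * r * Dw (Dv F) t u v (X6 e)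
      + r\<^sup>2 * Dw (Dw F) t u v (X3 e)) / 2)"
  have eq: "F t (u + e * p) (v + e * q) (w + e * r) - F t u v w
      - e * (p * Du F t u v w + q * Dv F t u v w + r * Dw F t u v w) = e\<^sup>2 * R e" for e
    unfolding R_def X1[THEN spec, THEN conjunct2] X2[THEN spec, THEN conjunct2] X3[THEN spec, THEN conjunct2]
      X4[THEN spec, THEN conjunct2] X5[THEN spec, THEN conjunct2] X6[THEN spec, THEN conjunct2]
    by (simp add: power2_eq_square algebra_simps add_divide_distrib)
  have line: "((\<lambda>e::real. c + e * d) \<longlongrightarrow> c) (at 0)" for c d
    by (rule tendsto_if_dist_le_linear[where c = d]) simp
  note lims = line tendsto_const X1[THEN spec, THEN conjunct1, THEN tendsto_if_dist_le_linear] X2[THEN spec, THEN conjunct1, THEN tendsto_if_dist_le_linear]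
    X3[THEN spec, THEN conjunct1, THEN tendsto_if_dist_le_linear] X4[THEN spec, THEN conjunct1, THEN tendsto_if_dist_le_linear]
    X5[THEN spec, THEN conjunct1, THEN tendsto_if_dist_le_linear] X6[THEN spec, THEN conjunct1, THEN tendsto_if_dist_le_linear]
  have jc: "jointly_continuous D (Du (Du F))" "jointly_continuous D (Dv (Du F))" "jointly_continuous D (Dw (Du F))"
    "jointly_continuous D (Dv (Dv F))" "jointly_continuous D (Dw (Dv F))" "jointly_continuous D (Dw (Dw F))"
    using C by auto
  note jts = jc[THEN jointly_continuous_tendsto, OF t]
  have "(R \<longlongrightarrow> hessian_form F t u v w p q r / 2) (at 0)"
    unfolding R_def hessian_form_def
    by (intro tendsto_divide tendsto_add tendsto_mult_left jts lims) simp
  moreover have "\<forall>\<^sub>F e in at 0. R e = (F t (u + e * p) (v + e * q) (w + e * r) - F t u v w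
             - e * (p * Du F t u v w + q * Dv F t u v w + r * Dw F t u v w)) / e\<^sup>2"
    by (simp add: eq eventually_at_filter)
  ultimately show ?thesis by (rule Lim_transform_eventually)
qed

section \<open>Grids and linearity of the fractional differences\<close>

lemma hgrid_eq_image:
  assumes "h > 0"
  shows "hgrid h c (c + real m * h) = (\<lambda>i. c + real i * h) ` {..m}"
  using assms by (auto simp: hgrid_def image_iff)

lemma delta_integral_eq_sum:
  assumes "h > 0"
  shows "delta_integral h c (c + real m * h) f = (\<Sum>i<m. f (c + real i * h) * h)"
  using assms by (simp add: delta_integral_def)

lemma left_sum_linear:
  "left_sum h a \<mu> (\<lambda>s. c * f s + e * g s) x = c * left_sum h a \<mu> f x + e * left_sum h a \<mu> g x"
  by (simp add: left_sum_def Let_def algebra_simps sum.distrib sum_distrib_left)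

lemma right_sum_linear:
  "right_sum h b \<mu> (\<lambda>s. c * f s + e * g s) x = c * right_sum h b \<mu> f x + e * right_sum h b \<mu> g x"
  by (simp add: right_sum_def Let_def algebra_simps sum.distrib sum_distrib_left)

lemma left_diff_linear:
  "left_diff h a \<alpha> (\<lambda>s. c * f s + e * g s) t = c * left_diff h a \<alpha> f t + e * left_diff h a \<alpha> g t"
  by (simp add: left_diff_def delta_deriv_def left_sum_linear algebra_simps add_divide_distrib diff_divide_distrib)

lemma right_diff_linear:
  "right_diff h b \<beta> (\<lambda>s. c * f s + e * g s) t = c * right_diff h b \<beta> f t + e * right_diff h b \<beta> g t"
  by (simp add: right_diff_def delta_deriv_def right_sum_linear algebra_simps add_divide_distrib diff_divide_distrib)

lemma frac_norm_scale:
  assumes "h > 0" "k \<ge> 1" "b = a + real k * h"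
  shows "frac_norm h a b \<alpha> \<beta> (\<lambda>s. e * f s) = \<bar>e\<bar> * frac_norm h a b \<alpha> \<beta> f"
proof -
  have "b - h = a + real (k - 1) * h" using assms by (simp add: algebra_simps of_nat_diff)
  then have G: "hgrid h a (b - h) = (\<lambda>i. a + real i * h) ` {..k - 1}"
    using hgrid_eq_image[OF \<open>h > 0\<close>] by metis
  have M: "(MAX t \<in> hgrid h a (b - h). \<bar>e\<bar> * g t) = \<bar>e\<bar> * (MAX t \<in> hgrid h a (b - h). g t)" for g :: "real \<Rightarrow> real"
    using mono_Max_commute[of "\<lambda>x. \<bar>e\<bar> * x" "g ` hgrid h a (b - h)"]
    by (simp add: G monoI mult_left_mono image_image)
  have l: "left_diff h a \<alpha> (\<lambda>s. e * f s) t = e * left_diff h a \<alpha> f t" for t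
    using left_diff_linear[of h a \<alpha> 0 "\<lambda>_. 0" e f t] by simp
  have r: "right_diff h b \<beta> (\<lambda>s. e * f s) t = e * right_diff h b \<beta> f t" for t
    using right_diff_linear[of h b \<beta> 0 "\<lambda>_. 0" e f t] by simp
  show ?thesis
    by (simp add: frac_norm_def l r abs_mult M distrib_left)
qed

section \<open>The second variation at a local minimum\<close>

text \<open>Since the fractional differences are linear, \<open>yh + e * \<eta>\<close> moves the arguments of \<open>L\<close> at each
  grid point along a straight line, and for small \<open>e\<close> it is an admissible competitor near \<open>yh\<close>.
  In the symmetric second difference of the functional at \<open>e = 0\<close> the first-order terms cancel;
  it is nonnegative by minimality, and divided by the square of \<open>e\<close> it tends to the sum below.\<close>
lemma second_variation_nonneg:
  assumes h: "h > 0" and k: "k \<ge> 1" and b: "b = a + real k * h"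
    and cont: "continuous_second_partials (hgrid h a (b - h)) L"
    and min: "local_minimum h a b \<alpha> \<beta> L A B yh"
    and \<eta>: "\<eta> a = 0" "\<eta> b = 0"
  shows "0 \<le> (\<Sum>i<k. let t = a + real i * h in
           hessian_form L t (yh (fwd h t)) (left_diff h a \<alpha> yh t) (right_diff h b \<beta> yh t)
             (\<eta> (fwd h t)) (left_diff h a \<alpha> \<eta> t) (right_diff h b \<beta> \<eta> t))"
proof -
  define x where "x i = a + real i * h" for i
  define Q where "Q t = hessian_form L t (yh (fwd h t)) (left_diff h a \<alpha> yh t) (right_diff h b \<beta> yh t)
             (\<eta> (fwd h t)) (left_diff h a \<alpha> \<eta> t) (right_diff h b \<beta> \<eta> t)" for t
  define \<Phi> where "\<Phi> e t = along h a b \<alpha> \<beta> L (\<lambda>s. yh s + e * \<eta> s) t" for e t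
  define S where "S e t = (\<Phi> e t - \<Phi> 0 t) / e\<^sup>2 + (\<Phi> (- e) t - \<Phi> 0 t) / e\<^sup>2" for e t
  have l: "left_diff h a \<alpha> (\<lambda>s. yh s + e * \<eta> s) t = left_diff h a \<alpha> yh t + e * left_diff h a \<alpha> \<eta> t" for e t
    using left_diff_linear[of h a \<alpha> 1 yh e \<eta> t] by simp
  have r: "right_diff h b \<beta> (\<lambda>s. yh s + e * \<eta> s) t = right_diff h b \<beta> yh t + e * right_diff h b \<beta> \<eta> t" for e t
    using right_diff_linear[of h b \<beta> 1 yh e \<eta> t] by simp
  have lim: "((\<lambda>e. S e (x i)) \<longlongrightarrow> Q (x i)) (at 0)" if "i < k" for i
  proof -
    have t: "x i \<in> hgrid h a (b - h)"
    proof -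
      have "real i + 1 \<le> real k" using that by linarith
      then have "(real i + 1) * h \<le> real k * h" using h by (simp add: mult_right_mono)
      then show ?thesis by (auto simp: hgrid_def x_def b algebra_simps)
    qed
    define G where "G = (\<lambda>e. (\<Phi> e (x i) - \<Phi> 0 (x i)
       - e * (\<eta> (fwd h (x i)) * along h a b \<alpha> \<beta> (Du L) yh (x i) + left_diff h a \<alpha> \<eta> (x i) * along h a b \<alpha> \<beta> (Dv L) yh (x i)
              + right_diff h b \<beta> \<eta> (x i) * along h a b \<alpha> \<beta> (Dw L) yh (x i))) / e\<^sup>2)"
    have 1: "(G \<longlongrightarrow> Q (x i) / 2) (at 0)"
      using second_order_expansion[OF cont t]
      unfolding G_def \<Phi>_def along_def Q_def l r by simp
    then have 2: "((\<lambda>e. G (- e)) \<longlongrightarrow> Q (x i) / 2) (at 0)"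
      by (rule filterlim_compose) (simp add: filterlim_def filtermap_at_minus)
    have "((\<lambda>e. G e + G (- e)) \<longlongrightarrow> Q (x i)) (at 0)"
      using tendsto_add[OF 1 2] by simp
    moreover have "G e + G (- e) = S e (x i)" for e
      by (simp add: G_def S_def diff_divide_distrib)
    ultimately show ?thesis by simp
  qed
  obtain \<delta> where \<delta>: "\<delta> > 0" "yh a = A" "yh b = B"
    "\<And>y. y a = A \<Longrightarrow> y b = B \<Longrightarrow> frac_norm h a b \<alpha> \<beta> (\<lambda>t. y t - yh t) < \<delta> \<Longrightarrow>
        functional h a b \<alpha> \<beta> L yh \<le> functional h a b \<alpha> \<beta> L y"
    using min unfolding local_minimum_def by blast
  have fsum: "functional h a b \<alpha> \<beta> L (\<lambda>s. yh s + e * \<eta> s) = h * (\<Sum>i<k. \<Phi> e (x i))" for e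
    unfolding functional_def \<Phi>_def x_def sum_distrib_left b delta_integral_eq_sum[OF h]
    by (simp only: mult.commute)
  have le: "(\<Sum>i<k. \<Phi> 0 (x i)) \<le> (\<Sum>i<k. \<Phi> e (x i))" if "\<bar>e\<bar> * frac_norm h a b \<alpha> \<beta> \<eta> < \<delta>" for e
  proof -
    have "functional h a b \<alpha> \<beta> L yh \<le> functional h a b \<alpha> \<beta> L (\<lambda>s. yh s + e * \<eta> s)"
      by (rule \<delta>(4)) (use that \<delta>(2,3) \<eta> in \<open>simp_all add: frac_norm_scale[OF h k b]\<close>)
    then show ?thesis using fsum[of e] fsum[of 0] h by simp
  qed
  have "((\<lambda>e::real. \<bar>e\<bar> * frac_norm h a b \<alpha> \<beta> \<eta>) \<longlongrightarrow> \<bar>0\<bar> * frac_norm h a b \<alpha> \<beta> \<eta>) (at 0)"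
    by (intro tendsto_intros)
  then have "\<forall>\<^sub>F e in at (0::real). \<bar>e\<bar> * frac_norm h a b \<alpha> \<beta> \<eta> < \<delta>"
    using \<delta>(1) by (intro order_tendstoD) auto
  then have ev: "\<forall>\<^sub>F e in at (0::real). 0 \<le> (\<Sum>i<k. S e (x i))"
  proof eventually_elim
    case (elim e)
    have "(\<Sum>i<k. S e (x i)) = ((\<Sum>i<k. \<Phi> e (x i)) - (\<Sum>i<k. \<Phi> 0 (x i))) / e\<^sup>2
        + ((\<Sum>i<k. \<Phi> (- e) (x i)) - (\<Sum>i<k. \<Phi> 0 (x i))) / e\<^sup>2"
      unfolding S_def sum.distrib sum_divide_distrib[symmetric] sum_subtractf ..
    then show ?case using le[of e] le[of "- e"] elim by simp
  qed
  have "((\<lambda>e. \<Sum>i<k. S e (x i)) \<longlongrightarrow> (\<Sum>i<k. Q (x i))) (at 0)"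
    by (intro tendsto_sum lim) simp
  then have "0 \<le> (\<Sum>i<k. Q (x i))"
    using ev by (rule tendsto_lowerbound) simp
  then show ?thesis by (simp add: Q_def x_def Let_def)
qed

section \<open>Weights of fractional sums and differences\<close>

text \<open>The coefficient of the \<open>m\<close>-th power of \<open>z\<close> in \<open>(1 - z) powr (- \<mu>)\<close>. These are the weights of
  a fractional sum of order \<open>\<mu>\<close>, up to \<open>h powr \<mu>\<close>. Unlike a quotient of Gamma values they make sense for every real
  \<open>\<mu>\<close>, so that \<open>\<mu> = 0\<close> (no summation) is no exception.\<close>
definition rising_coeff :: "real \<Rightarrow> nat \<Rightarrow> real" where
  "rising_coeff \<mu> m = pochhammer \<mu> m / fact m"

lemma rising_coeff_0 [simp]: "rising_coeff \<mu> 0 = 1"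
  by (simp add: rising_coeff_def)

text \<open>Taking differences of the coefficients multiplies the generating function by \<open>1 - z\<close>, which
  lowers the order by one.\<close>
lemma rising_coeff_diff:
  "rising_coeff \<mu> (Suc m) - rising_coeff \<mu> m = rising_coeff (\<mu> - 1) (Suc m)"
proof -
  have "pochhammer (\<mu> - 1) (Suc m) = (\<mu> - 1) * pochhammer \<mu> m"
    by (simp add: pochhammer_rec)
  then have 1: "rising_coeff (\<mu> - 1) (Suc m) = (\<mu> - 1) * pochhammer \<mu> m / fact (Suc m)"
    by (simp add: rising_coeff_def)
  show ?thesis
    unfolding 1 unfolding rising_coeff_def pochhammer_Suc by (simp add: divide_simps) (simp add: algebra_simps)
qed

lemma hfactorial_mult:
  "h > 0 \<Longrightarrow> hfactorial h (x * h) y = h powr y * Gamma (x + 1) / Gamma (x + 1 - y)"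
  by (simp add: hfactorial_def)

lemma sum_kernel_eq:
  assumes "h > 0" "\<mu> > 0"
  shows "1 / Gamma \<mu> * (hfactorial h ((real m + \<mu> - 1) * h) (\<mu> - 1) * h) = h powr \<mu> * rising_coeff \<mu> m"
proof -
  have "\<mu> \<notin> \<int>\<^sub>\<le>\<^sub>0" using assms by (auto elim!: nonpos_Ints_cases)
  then have "rising_coeff \<mu> m = Gamma (real m + \<mu>) / Gamma \<mu> / Gamma (real m + 1)"
    by (simp add: rising_coeff_def pochhammer_Gamma Gamma_fact add.commute)
  moreover have "h powr (\<mu> - 1) * h = h powr \<mu>"
    using assms by (simp add: powr_diff)
  ultimately show ?thesis
    using assms by (subst hfactorial_mult) (simp_all add: mult_ac)
qed

text \<open>For \<open>\<mu> > 0\<close> the factor \<open>\<mu>\<close> turns \<open>Gamma (\<mu> + 1)\<close> into \<open>Gamma \<mu>\<close>, the quotient of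
  \<open>Gamma (m + \<mu>)\<close> by it is \<open>pochhammer \<mu> m\<close>, and the factor \<open>\<mu> - 1\<close> extends this product
  by one place downwards. For \<open>\<mu> = 0\<close> the left side vanishes because of the
  factor \<open>\<mu>\<close>, while \<open>rising_coeff (- 1) (Suc m)\<close> vanishes only from \<open>m = 1\<close> on.\<close>
lemma difference_kernel_eq:
  assumes "h > 0" "\<mu> \<ge> 0" "m \<ge> 1"
  shows "\<mu> * (\<mu> - 1) / Gamma (\<mu> + 1) * hfactorial h ((real m + \<mu> - 1) * h) (\<mu> - 2)
    = h powr \<mu> / h\<^sup>2 * rising_coeff (\<mu> - 1) (Suc m)"
proof -
  have p: "pochhammer (\<mu> - 1) (Suc m) = (\<mu> - 1) * pochhammer \<mu> m"
    by (simp add: pochhammer_rec)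
  have hp: "h powr (\<mu> - 2) = h powr \<mu> / h\<^sup>2"
    using assms by (simp add: powr_diff)
  have gf: "Gamma (real m + 2) = fact (Suc m)"
    using Gamma_fact[of "Suc m", where ?'a = real] by (simp add: add.commute)
  show ?thesis
  proof (cases "\<mu> = 0")
    case True
    then show ?thesis using assms p by (simp add: rising_coeff_def pochhammer_0_left)
  next
    case False
    then have \<mu>: "\<mu> \<notin> \<int>\<^sub>\<le>\<^sub>0" using assms by (auto elim!: nonpos_Ints_cases)
    then have "Gamma (\<mu> + 1) = \<mu> * Gamma \<mu>" "Gamma \<mu> \<noteq> 0"
      by (auto simp: Gamma_plus1 Gamma_eq_zero_iff)
    moreover have "pochhammer \<mu> m = Gamma (real m + \<mu>) / Gamma \<mu>"
      using \<mu> by (simp add: pochhammer_Gamma add.commute)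
    ultimately show ?thesis
      using assms False by (subst hfactorial_mult) (simp_all add: rising_coeff_def p hp gf add.commute mult_ac)
  qed
qed

section \<open>Fractional sums and differences of a spike\<close>

lemma left_sum_spike:
  assumes h: "h > 0" and \<mu>: "\<mu> \<ge> 0"
  shows "left_sum h a \<mu> (indicat_real {a + real j * h}) (a + real i * h + \<mu> * h) =
    (if j \<le> i then h powr \<mu> * rising_coeff \<mu> (i - j) else 0)"
proof (cases "\<mu> = 0")
  case True
  then show ?thesis using h
    by (auto simp: left_sum_def rising_coeff_def pochhammer_0_left indicator_def)
next
  case False
  let ?K = "\<lambda>s. hfactorial h (a + real i * h + \<mu> * h - fwd h s) (\<mu> - 1)"
  have "left_sum h a \<mu> (indicat_real {a + real j * h}) (a + real i * h + \<mu> * h)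
    = 1 / Gamma \<mu> * (\<Sum>s\<in>hgrid h a (a + real i * h). if s = a + real j * h then ?K s * h else 0)"
    using False by (auto simp: left_sum_def Let_def indicator_def intro!: sum.cong)
  also have "\<dots> = (if j \<le> i then 1 / Gamma \<mu> * (?K (a + real j * h) * h) else 0)"
    using h by (auto simp: hgrid_eq_image sum.delta)
  also have "j \<le> i \<Longrightarrow> a + real i * h + \<mu> * h - fwd h (a + real j * h) = (real (i - j) + \<mu> - 1) * h"
    by (simp add: fwd_def of_nat_diff algebra_simps)
  ultimately show ?thesis
    using sum_kernel_eq[of h \<mu> "i - j"] h \<mu> False by (auto simp del: of_nat_diff)
qed

lemma right_sum_spike:
  assumes h: "h > 0" and \<mu>: "\<mu> \<ge> 0" and b: "b = a + real k * h" and "j \<le> k" "i \<le> k"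
  shows "right_sum h b \<mu> (indicat_real {a + real j * h}) (a + real i * h - \<mu> * h) =
    (if i \<le> j then h powr \<mu> * rising_coeff \<mu> (j - i) else 0)"
proof (cases "\<mu> = 0")
  case True
  then show ?thesis using h
    by (auto simp: right_sum_def rising_coeff_def pochhammer_0_left indicator_def)
next
  case False
  let ?K = "\<lambda>s. hfactorial h (s + \<mu> * h - fwd h (a + real i * h)) (\<mu> - 1)"
  have "b = (a + real i * h) + real (k - i) * h" using assms by (simp add: of_nat_diff algebra_simps)
  then have G: "hgrid h (a + real i * h) b = (\<lambda>m. a + real i * h + real m * h) ` {..k - i}"
    using hgrid_eq_image[OF h] by metis
  have mem: "a + real j * h \<in> hgrid h (a + real i * h) b \<longleftrightarrow> i \<le> j"
  proof
    assume "a + real j * h \<in> hgrid h (a + real i * h) b"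
    then obtain m where "a + real j * h = a + real i * h + real m * h" unfolding G by blast
    then have "real j * h = (real i + real m) * h" by (simp add: algebra_simps)
    then have "real j = real i + real m" using h by simp
    then show "i \<le> j" by linarith
  next
    assume "i \<le> j"
    then show "a + real j * h \<in> hgrid h (a + real i * h) b"
      unfolding G using assms by (intro image_eqI[of _ _ "j - i"]) (auto simp: of_nat_diff algebra_simps)
  qed
  have "right_sum h b \<mu> (indicat_real {a + real j * h}) (a + real i * h - \<mu> * h)
    = 1 / Gamma \<mu> * (\<Sum>s\<in>hgrid h (a + real i * h) b. if s = a + real j * h then ?K s * h else 0)"
    using False by (auto simp: right_sum_def Let_def indicator_def intro!: sum.cong)
  also have "\<dots> = (if i \<le> j then 1 / Gamma \<mu> * (?K (a + real j * h) * h) else 0)"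
    using mem by (simp add: sum.delta G)
  also have "i \<le> j \<Longrightarrow> a + real j * h + \<mu> * h - fwd h (a + real i * h) = (real (j - i) + \<mu> - 1) * h"
    by (simp add: fwd_def of_nat_diff algebra_simps)
  ultimately show ?thesis
    using sum_kernel_eq[of h \<mu> "j - i"] h \<mu> False by (auto simp del: of_nat_diff)
qed

text \<open>The spike sits at the index \<open>Suc n\<close>; the forward difference sees it first at \<open>n\<close>, which is why
  the coefficient index is \<open>i - n\<close>.\<close>
lemma left_diff_spike:
  assumes h: "h > 0" and "\<alpha> \<le> 1"
  shows "left_diff h a \<alpha> (indicat_real {a + real (Suc n) * h}) (a + real i * h) =
    (if n \<le> i then h powr (1 - \<alpha>) / h * rising_coeff (- \<alpha>) (i - n) else 0)"
proof -
  have s: "a + real i * h + h = a + real (Suc i) * h" by (simp add: algebra_simps)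
  have F: "left_sum h a (1 - \<alpha>) (indicat_real {a + real (Suc n) * h}) (a + real m * h + (1 - \<alpha>) * h)
    = (if Suc n \<le> m then h powr (1 - \<alpha>) * rising_coeff (1 - \<alpha>) (m - Suc n) else 0)" for m
    by (rule left_sum_spike) (use assms in auto)
  consider "i < n" | "i = n" | m where "i = Suc n + m"
    by (metis less_imp_Suc_add linorder_neqE_nat add_Suc)
  then show ?thesis
  proof cases
    case 3
    then show ?thesis
      unfolding left_diff_def delta_deriv_def s F
      using rising_coeff_diff[of "1 - \<alpha>" m]
      by (simp add: Suc_diff_le flip: right_diff_distrib)
  next
    case 1
    then show ?thesis
      unfolding left_diff_def delta_deriv_def s F by simp
  next
    case 2
    then show ?thesis
      unfolding left_diff_def delta_deriv_def s F by simp
  qed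
qed

text \<open>The right sum is anticipating, so the response to the spike is supported at and before the
  spike, and its coefficients run backwards from there.\<close>
lemma right_diff_spike:
  assumes h: "h > 0" and "\<beta> \<le> 1" and b: "b = a + real k * h" and "n < k" "i < k"
  shows "right_diff h b \<beta> (indicat_real {a + real (Suc n) * h}) (a + real i * h) =
    (if i \<le> Suc n then h powr (1 - \<beta>) / h * rising_coeff (- \<beta>) (Suc n - i) else 0)"
proof -
  have s: "a + real i * h + h = a + real (Suc i) * h" by (simp add: algebra_simps)
  have F: "right_sum h b (1 - \<beta>) (indicat_real {a + real (Suc n) * h}) (a + real m * h - (1 - \<beta>) * h)
    = (if m \<le> Suc n then h powr (1 - \<beta>) * rising_coeff (1 - \<beta>) (Suc n - m) else 0)" if "m \<le> k" for m
    by (rule right_sum_spike[OF h _ b]) (use assms that in auto)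
  have "i \<le> k" "Suc i \<le> k" using \<open>i < k\<close> by auto
  note F = F[OF this(1)] F[OF this(2)]
  consider "i > Suc n" | "i = Suc n" | m where "n = i + m"
    by (metis le_Suc_ex linorder_not_less not_less_eq_eq nat_less_le)
  then show ?thesis
  proof cases
    case 3
    then show ?thesis
      unfolding right_diff_def delta_deriv_def s F
      using rising_coeff_diff[of "1 - \<beta>" m]
      by (simp add: Suc_diff_le flip: right_diff_distrib minus_divide_left)
         (simp add: algebra_simps)
  next
    case 1
    then show ?thesis
      unfolding right_diff_def delta_deriv_def s F by simp
  next
    case 2
    then show ?thesis
      unfolding right_diff_def delta_deriv_def s F by simp
  qed
qed

section \<open>The necessary condition\<close>

theorem theorem3p6:
  fixes a b h \<alpha> \<beta> \<gamma> \<nu> A B :: real and k :: nat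
    and L :: "real \<Rightarrow> real \<Rightarrow> real \<Rightarrow> real \<Rightarrow> real" and yh :: "real \<Rightarrow> real"
  assumes "h > 0" and "k \<ge> 1" and "b = a + real k * h"
    and "0 < \<alpha>" and "\<alpha> \<le> 1" and "0 < \<beta>" and "\<beta> \<le> 1"
    and "\<gamma> = 1 - \<alpha>" and "\<nu> = 1 - \<beta>"
    and "continuous_second_partials (hgrid h a (b - h)) L"
    and "local_minimum h a b \<alpha> \<beta> L A B yh"
  shows "\<forall>t \<in> hgrid h a (b - 2 * h).
      h\<^sup>2 * along h a b \<alpha> \<beta> (Du (Du L)) yh t
    + 2 * h powr (\<gamma> + 1) * along h a b \<alpha> \<beta> (Dv (Du L)) yh t
    + 2 * h powr (\<nu> + 1) * (\<nu> - 1) * along h a b \<alpha> \<beta> (Dw (Du L)) yh t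
    + h powr (2 * \<gamma>) * (\<gamma> - 1)\<^sup>2 * along h a b \<alpha> \<beta> (Dv (Dv L)) yh (fwd h t)
    + 2 * h powr (\<nu> + \<gamma>) * (\<gamma> - 1) * along h a b \<alpha> \<beta> (Dw (Dv L)) yh (fwd h t)
    + 2 * h powr (\<nu> + \<gamma>) * (\<nu> - 1) * along h a b \<alpha> \<beta> (Dw (Dv L)) yh t
    + h powr (2 * \<nu>) * (\<nu> - 1)\<^sup>2 * along h a b \<alpha> \<beta> (Dw (Dw L)) yh t
    + h powr (2 * \<nu>) * along h a b \<alpha> \<beta> (Dw (Dw L)) yh (fwd h t)
    + delta_integral h a t (\<lambda>s. h ^ 3 * along h a b \<alpha> \<beta> (Dw (Dw L)) yh s *
        (\<nu> * (1 - \<nu>) / Gamma (\<nu> + 1) * hfactorial h (t + \<nu> * h - fwd h s) (\<nu> - 2))\<^sup>2)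
    + h powr (2 * \<gamma>) * along h a b \<alpha> \<beta> (Dv (Dv L)) yh t
    + delta_integral h (fwd h (fwd h t)) b (\<lambda>s. h ^ 3 * along h a b \<alpha> \<beta> (Dv (Dv L)) yh s *
        (\<gamma> * (\<gamma> - 1) / Gamma (\<gamma> + 1) * hfactorial h (s + \<gamma> * h - fwd h (fwd h t)) (\<gamma> - 2))\<^sup>2)
    \<ge> 0"
proof
  fix t assume "t \<in> hgrid h a (b - 2 * h)"
  then obtain n where t: "t = a + real n * h" and "a + real n * h \<le> b - 2 * h"
    by (auto simp: hgrid_def)
  then have "(real n + 2) * h \<le> real k * h"
    using assms(3) by (simp add: algebra_simps)
  then have "real n + 2 \<le> real k"
    using \<open>h > 0\<close> by simp
  then have "n + 2 \<le> k"
    by linarith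
  then obtain m where k: "k = Suc (Suc n) + m"
    using le_Suc_ex[of "n + 2" k] by auto
  define x where "x i = a + real i * h" for i
  \<comment> \<open>\<open>Suc n\<close> is the index of \<open>fwd h t\<close>, which lies strictly between the ends of the grid.\<close>
  define \<eta> where "\<eta> = indicat_real {a + real (Suc n) * h}"
  define P where "P = h powr \<gamma>"
  define R where "R = h powr \<nu>"
  define uu where "uu i = along h a b \<alpha> \<beta> (Du (Du L)) yh (x i)" for i
  define uv where "uv i = along h a b \<alpha> \<beta> (Dv (Du L)) yh (x i)" for i
  define uw where "uw i = along h a b \<alpha> \<beta> (Dw (Du L)) yh (x i)" for i
  define vv where "vv i = along h a b \<alpha> \<beta> (Dv (Dv L)) yh (x i)" for i
  define vw where "vw i = along h a b \<alpha> \<beta> (Dw (Dv L)) yh (x i)" for i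
  define ww where "ww i = along h a b \<alpha> \<beta> (Dw (Dw L)) yh (x i)" for i
  \<comment> \<open>The contribution of the grid point \<open>x i\<close> to the second variation.\<close>
  define E where "E i = hessian_form L (x i) (yh (fwd h (x i))) (left_diff h a \<alpha> yh (x i))
      (right_diff h b \<beta> yh (x i)) (\<eta> (fwd h (x i))) (left_diff h a \<alpha> \<eta> (x i)) (right_diff h b \<beta> \<eta> (x i))" for i
  have h: "h > 0" and order: "\<gamma> \<ge> 0" "\<nu> \<ge> 0" "- \<alpha> = \<gamma> - 1" "- \<beta> = \<nu> - 1"
    using assms by auto
  have "\<eta> a = 0" "\<eta> b = 0"
    using h by (auto simp: \<eta>_def indicator_def assms(3) k)
  then have nonneg: "0 \<le> (\<Sum>i<k. E i)"
    using second_variation_nonneg[OF h assms(2,3,10,11)] by (simp add: E_def x_def Let_def)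

  have U: "\<eta> (fwd h (x i)) = (if i = n then 1 else 0)" for i
  proof -
    have "fwd h (x i) = a + real (Suc i) * h" by (simp add: fwd_def x_def algebra_simps)
    then show ?thesis using h by (simp add: \<eta>_def indicator_def)
  qed
  have V: "left_diff h a \<alpha> \<eta> (x i) = (if n \<le> i then P / h * rising_coeff (\<gamma> - 1) (i - n) else 0)" for i
    unfolding \<eta>_def x_def left_diff_spike[OF h assms(5)] order(3) P_def assms(8) ..
  have W: "right_diff h b \<beta> \<eta> (x i) = (if i \<le> Suc n then R / h * rising_coeff (\<nu> - 1) (Suc n - i) else 0)"
    if "i < k" for i
    unfolding \<eta>_def x_def R_def assms(9)
    using right_diff_spike[OF h assms(7,3), of n i] that k by simp
  have E: "E i = (\<eta> (fwd h (x i)))\<^sup>2 * uu i + 2 * \<eta> (fwd h (x i)) * left_diff h a \<alpha> \<eta> (x i) * uv i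
      + 2 * \<eta> (fwd h (x i)) * right_diff h b \<beta> \<eta> (x i) * uw i + (left_diff h a \<alpha> \<eta> (x i))\<^sup>2 * vv i
      + 2 * left_diff h a \<alpha> \<eta> (x i) * right_diff h b \<beta> \<eta> (x i) * vw i + (right_diff h b \<beta> \<eta> (x i))\<^sup>2 * ww i" for i
    by (simp add: E_def hessian_form_def along_def uu_def uv_def uw_def vv_def vw_def ww_def)
  have c1: "rising_coeff \<mu> (Suc 0) = \<mu>" for \<mu>
    by (simp add: rising_coeff_def)

  \<comment> \<open>Below \<open>n\<close> the left difference of the spike vanishes, above \<open>Suc n\<close> the right one; the factor \<open>h\<^sup>2\<close> clears the denominators of the differences.\<close>
  have before: "h\<^sup>2 * E i = (R * rising_coeff (\<nu> - 1) (Suc n - i))\<^sup>2 * ww i" if "i < n" for i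
    using that h k W[of i] by (simp add: E U V power_mult_distrib power_divide)
  have Wt: "right_diff h b \<beta> \<eta> (x n) = R / h * (\<nu> - 1)"
    using W[of n] k by (simp add: c1)
  have at_t: "h\<^sup>2 * E n = h\<^sup>2 * uu n + 2 * (P * h) * uv n + 2 * (R * h) * (\<nu> - 1) * uw n + P\<^sup>2 * vv n
      + 2 * (R * P) * (\<nu> - 1) * vw n + R\<^sup>2 * (\<nu> - 1)\<^sup>2 * ww n"
    using h by (simp add: E U V Wt c1) (simp add: field_simps power2_eq_square)
  have Wn: "right_diff h b \<beta> \<eta> (x (Suc n)) = R / h"
    using W[of "Suc n"] k by simp
  have at_next: "h\<^sup>2 * E (Suc n) = P\<^sup>2 * (\<gamma> - 1)\<^sup>2 * vv (Suc n) + 2 * (R * P) * (\<gamma> - 1) * vw (Suc n) + R\<^sup>2 * ww (Suc n)"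
    using h by (simp add: E U V Wn c1) (simp add: field_simps power2_eq_square)
  have after: "h\<^sup>2 * E (Suc (Suc n) + i) = (P * rising_coeff (\<gamma> - 1) (Suc (Suc i)))\<^sup>2 * vv (Suc (Suc n) + i)" if "i < m" for i
    using that h k W[of "Suc (Suc n) + i"] by (simp add: E U V power_mult_distrib power_divide)

  have int_left: "delta_integral h a t (\<lambda>s. h ^ 3 * along h a b \<alpha> \<beta> (Dw (Dw L)) yh s *
        (\<nu> * (1 - \<nu>) / Gamma (\<nu> + 1) * hfactorial h (t + \<nu> * h - fwd h s) (\<nu> - 2))\<^sup>2)
      = (\<Sum>i<n. h\<^sup>2 * E i)"
    unfolding t delta_integral_eq_sum[OF h]
  proof (rule sum.cong)
    fix i assume "i \<in> {..<n}"
    then have i: "i < n" by simp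
    have arg: "a + real n * h + \<nu> * h - fwd h (a + real i * h) = (real (n - i) + \<nu> - 1) * h"
      using i by (simp add: fwd_def of_nat_diff algebra_simps)
    have "\<nu> * (1 - \<nu>) = - (\<nu> * (\<nu> - 1))"
      by (simp add: algebra_simps)
    moreover have "\<nu> * (\<nu> - 1) / Gamma (\<nu> + 1) * hfactorial h ((real (n - i) + \<nu> - 1) * h) (\<nu> - 2)
        = R / h\<^sup>2 * rising_coeff (\<nu> - 1) (Suc (n - i))"
      unfolding R_def by (rule difference_kernel_eq[OF h order(2)]) (use i in simp)
    \<comment> \<open>The sign, from \<open>1 - \<nu>\<close> in place of \<open>\<nu> - 1\<close>, disappears in the square.\<close>
    ultimately have K: "\<nu> * (1 - \<nu>) / Gamma (\<nu> + 1) * hfactorial h ((real (n - i) + \<nu> - 1) * h) (\<nu> - 2)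
        = - (R / h\<^sup>2 * rising_coeff (\<nu> - 1) (Suc n - i))"
      using i by (simp only: minus_divide_left[symmetric] minus_mult_left[symmetric] Suc_diff_le less_imp_le)
    show "h ^ 3 * along h a b \<alpha> \<beta> (Dw (Dw L)) yh (a + real i * h) *
        (\<nu> * (1 - \<nu>) / Gamma (\<nu> + 1) * hfactorial h (a + real n * h + \<nu> * h - fwd h (a + real i * h)) (\<nu> - 2))\<^sup>2 * h
        = h\<^sup>2 * E i"
      unfolding arg K before[OF i] unfolding ww_def x_def using h
      by (simp add: field_simps power2_eq_square power3_eq_cube)
  qed simp
  have b: "b = fwd h (fwd h t) + real m * h"
    by (simp add: assms(3) k t fwd_def algebra_simps)
  have "delta_integral h (fwd h (fwd h t)) (fwd h (fwd h t) + real m * h)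
        (\<lambda>s. h ^ 3 * along h a b \<alpha> \<beta> (Dv (Dv L)) yh s *
        (\<gamma> * (\<gamma> - 1) / Gamma (\<gamma> + 1) * hfactorial h (s + \<gamma> * h - fwd h (fwd h t)) (\<gamma> - 2))\<^sup>2)
      = (\<Sum>i<m. h\<^sup>2 * E (Suc (Suc n) + i))"
    unfolding delta_integral_eq_sum[OF h]
  proof (rule sum.cong)
    fix i assume "i \<in> {..<m}"
    then have i: "i < m" by simp
    have arg: "fwd h (fwd h t) + real i * h + \<gamma> * h - fwd h (fwd h t) = (real (Suc i) + \<gamma> - 1) * h"
      by (simp add: algebra_simps)
    have pt: "fwd h (fwd h t) + real i * h = x (Suc (Suc n) + i)"
      by (simp add: t x_def fwd_def algebra_simps)
    have K: "\<gamma> * (\<gamma> - 1) / Gamma (\<gamma> + 1) * hfactorial h ((real (Suc i) + \<gamma> - 1) * h) (\<gamma> - 2)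
        = P / h\<^sup>2 * rising_coeff (\<gamma> - 1) (Suc (Suc i))"
      unfolding P_def by (rule difference_kernel_eq[OF h order(1)]) simp
    show "h ^ 3 * along h a b \<alpha> \<beta> (Dv (Dv L)) yh (fwd h (fwd h t) + real i * h) *
        (\<gamma> * (\<gamma> - 1) / Gamma (\<gamma> + 1) * hfactorial h (fwd h (fwd h t) + real i * h + \<gamma> * h - fwd h (fwd h t)) (\<gamma> - 2))\<^sup>2 * h
        = h\<^sup>2 * E (Suc (Suc n) + i)"
      unfolding arg K after[OF i] unfolding pt vv_def using h
      by (simp add: field_simps power2_eq_square power3_eq_cube)
  qed simp
  then have int_right: "delta_integral h (fwd h (fwd h t)) b (\<lambda>s. h ^ 3 * along h a b \<alpha> \<beta> (Dv (Dv L)) yh s *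
        (\<gamma> * (\<gamma> - 1) / Gamma (\<gamma> + 1) * hfactorial h (s + \<gamma> * h - fwd h (fwd h t)) (\<gamma> - 2))\<^sup>2)
      = (\<Sum>i<m. h\<^sup>2 * E (Suc (Suc n) + i))"
    unfolding b[symmetric] .

  have pw: "h powr (\<gamma> + 1) = P * h" "h powr (\<nu> + 1) = R * h" "h powr (2 * \<gamma>) = P\<^sup>2"
    "h powr (\<nu> + \<gamma>) = R * P" "h powr (2 * \<nu>) = R\<^sup>2"
    using h by (simp_all only: P_def R_def powr_add power2_eq_square mult_2 powr_one)
  have pts: "t = x n" "fwd h (x n) = x (Suc n)"
    by (simp_all add: t x_def fwd_def algebra_simps)
  have split: "(\<Sum>i<n + m. f i) = (\<Sum>i<n. f i) + (\<Sum>i<m. f (n + i))" for f :: "nat \<Rightarrow> real" and n m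
    by (induction m) (simp_all add: add.assoc)
  have "h\<^sup>2 * (\<Sum>i<k. E i) = (\<Sum>i<n. h\<^sup>2 * E i) + h\<^sup>2 * E n + h\<^sup>2 * E (Suc n) + (\<Sum>i<m. h\<^sup>2 * E (Suc (Suc n) + i))"
    unfolding k split by (simp add: distrib_left sum_distrib_left)
  then have total: "0 \<le> (\<Sum>i<n. h\<^sup>2 * E i) + h\<^sup>2 * E n + h\<^sup>2 * E (Suc n) + (\<Sum>i<m. h\<^sup>2 * E (Suc (Suc n) + i))"
    using nonneg h by (metis mult_nonneg_nonneg zero_le_power2)
  have vals: "along h a b \<alpha> \<beta> (Du (Du L)) yh t = uu n" "along h a b \<alpha> \<beta> (Dv (Du L)) yh t = uv n"
    "along h a b \<alpha> \<beta> (Dw (Du L)) yh t = uw n" "along h a b \<alpha> \<beta> (Dv (Dv L)) yh t = vv n"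
    "along h a b \<alpha> \<beta> (Dw (Dv L)) yh t = vw n" "along h a b \<alpha> \<beta> (Dw (Dw L)) yh t = ww n"
    "along h a b \<alpha> \<beta> (Dv (Dv L)) yh (fwd h t) = vv (Suc n)"
    "along h a b \<alpha> \<beta> (Dw (Dv L)) yh (fwd h t) = vw (Suc n)"
    "along h a b \<alpha> \<beta> (Dw (Dw L)) yh (fwd h t) = ww (Suc n)"
    by (simp_all add: uu_def uv_def uw_def vv_def vw_def ww_def pts)
  show "
      h\<^sup>2 * along h a b \<alpha> \<beta> (Du (Du L)) yh t
    + 2 * h powr (\<gamma> + 1) * along h a b \<alpha> \<beta> (Dv (Du L)) yh t
    + 2 * h powr (\<nu> + 1) * (\<nu> - 1) * along h a b \<alpha> \<beta> (Dw (Du L)) yh t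
    + h powr (2 * \<gamma>) * (\<gamma> - 1)\<^sup>2 * along h a b \<alpha> \<beta> (Dv (Dv L)) yh (fwd h t)
    + 2 * h powr (\<nu> + \<gamma>) * (\<gamma> - 1) * along h a b \<alpha> \<beta> (Dw (Dv L)) yh (fwd h t)
    + 2 * h powr (\<nu> + \<gamma>) * (\<nu> - 1) * along h a b \<alpha> \<beta> (Dw (Dv L)) yh t
    + h powr (2 * \<nu>) * (\<nu> - 1)\<^sup>2 * along h a b \<alpha> \<beta> (Dw (Dw L)) yh t
    + h powr (2 * \<nu>) * along h a b \<alpha> \<beta> (Dw (Dw L)) yh (fwd h t)
    + delta_integral h a t (\<lambda>s. h ^ 3 * along h a b \<alpha> \<beta> (Dw (Dw L)) yh s *
        (\<nu> * (1 - \<nu>) / Gamma (\<nu> + 1) * hfactorial h (t + \<nu> * h - fwd h s) (\<nu> - 2))\<^sup>2)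
    + h powr (2 * \<gamma>) * along h a b \<alpha> \<beta> (Dv (Dv L)) yh t
    + delta_integral h (fwd h (fwd h t)) b (\<lambda>s. h ^ 3 * along h a b \<alpha> \<beta> (Dv (Dv L)) yh s *
        (\<gamma> * (\<gamma> - 1) / Gamma (\<gamma> + 1) * hfactorial h (s + \<gamma> * h - fwd h (fwd h t)) (\<gamma> - 2))\<^sup>2)
    \<ge> 0"
    unfolding int_left int_right vals pw
    using total unfolding at_t at_next by linarith
qed

end
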